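(* Let $S$ be a numerical semigroup, $d\in\mathbb Z_{>0}$, and let $s\in S/d$ be nonzero. Let $Ap_{ds}(S)=\{a_0,a_1,\dots,a_{ds-1}\}$ be the Apéry set of $S$ with respect to $ds\in S$, indexed so that $a_l\equiv l\pmod{ds}$ for $l\in\{0,1,\dots,ds-1\}$. Then $$ g(S/d)=\sum_{i=1}^{s-1}\left[\frac{a_{di}}{ds}\right]. $$
   Context: A numerical semigroup is a set $S\subset\mathbb Z_{\ge 0}$ that contains $0$, is closed under addition, and has finite complement in $\mathbb Z_{\ge 0}$. Its genus $g(S)$ is the number of elements of $\mathbb Z_{\ge 0}\setminus S$. For $d\in\mathbb Z_{>0}$, $S/d:=\{s\in\mathbb Z_{\ge 0}:ds\in S\}$, which is again a numerical semigroup. For nonzero $u\in S$, the Apéry set is $Ap_u(S):=\{v\in S:v-u\notin S\}=\{a_0,a_1,\dots,a_{u-1}\}$, where $a_l:=\min((l+u\mathbb Z_{\ge 0})\cap S)$ for $l\in\{0,1,\dots,u-1\}$. $[x]$ is the integer part (floor) of $x$. *)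

theory Defs
  imports Complex_Main "HOL-Number_Theory.Cong"
begin

definition numerical_semigroup :: "nat set \<Rightarrow> bool" where
  "numerical_semigroup S \<longleftrightarrow>
     0 \<in> S \<and> (\<forall>x\<in>S. \<forall>y\<in>S. x + y \<in> S) \<and> finite (UNIV - S)"

definition genus :: "nat set \<Rightarrow> nat" where
  "genus S = card (UNIV - S)"

definition quotient_semigroup :: "nat set \<Rightarrow> nat \<Rightarrow> nat set" where
  "quotient_semigroup S d = {s. d * s \<in> S}"

text \<open>The difference \<open>v - u\<close> is taken in the integers, since truncated subtraction
  would wrongly exclude every \<open>v < u\<close> (because \<open>0 \<in> S\<close>).\<close>

definition Apery_set :: "nat \<Rightarrow> nat set \<Rightarrow> nat set" where
  "Apery_set u S = {v \<in> S. int v - int u \<notin> int ` S}"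

definition Apery_elem :: "nat \<Rightarrow> nat set \<Rightarrow> nat \<Rightarrow> nat" where
  "Apery_elem u S l = (LEAST a. a \<in> {l + u * k | k. True} \<inter> S)"

lemma numerical_semigroup_quotient:
  assumes "numerical_semigroup S" "d > 0"
  shows "numerical_semigroup (quotient_semigroup S d)"
proof -
  have "finite ((\<lambda>x. d * x) -` (UNIV - S))"
    using assms by (intro finite_vimageI) (auto simp: numerical_semigroup_def inj_on_def)
  moreover have "(\<lambda>x. d * x) -` (UNIV - S) = UNIV - quotient_semigroup S d"
    by (auto simp: quotient_semigroup_def)
  ultimately show ?thesis
    using assms by (simp add: numerical_semigroup_def quotient_semigroup_def distrib_left)
qed

lemma Apery_set_iff: "v \<in> Apery_set u S \<longleftrightarrow> v \<in> S \<and> (\<forall>w\<in>S. v \<noteq> w + u)"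
  by (force simp: Apery_set_def image_iff)

lemma Apery_elem_props:
  assumes S: "numerical_semigroup S" and u: "u > 0"
  shows "Apery_elem u S l \<in> S" "\<exists>k. Apery_elem u S l = l + u * k"
    "\<And>k. l + u * k \<in> S \<Longrightarrow> Apery_elem u S l \<le> l + u * k"
proof -
  have "infinite (range (\<lambda>k. l + u * k))"
    using u by (subst finite_image_iff) (auto simp: inj_on_def)
  moreover have "finite (UNIV - S)"
    using S by (simp add: numerical_semigroup_def)
  ultimately have "\<not> range (\<lambda>k. l + u * k) \<subseteq> UNIV - S"
    using finite_subset by blast
  then obtain k where "l + u * k \<in> S"
    by auto
  then have "Apery_elem u S l \<in> {l + u * k | k. True} \<inter> S"
    unfolding Apery_elem_def by (rule LeastI[of _ "l + u * k", OF IntI, rotated]) auto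
  then show "Apery_elem u S l \<in> S" "\<exists>k. Apery_elem u S l = l + u * k"
    by auto
  show "\<And>k. l + u * k \<in> S \<Longrightarrow> Apery_elem u S l \<le> l + u * k"
    unfolding Apery_elem_def by (rule Least_le) auto
qed

lemma Apery_elem_cong:
  assumes "numerical_semigroup S" "u > 0"
  shows "[Apery_elem u S l = l] (mod u)"
  using Apery_elem_props(2)[OF assms, of l] by (auto simp: cong_def)

lemma Apery_set_eq_image:
  assumes S: "numerical_semigroup S" and uS: "u \<in> S" and u: "u > 0"
  shows "Apery_set u S = Apery_elem u S ` {0..u - 1}"
proof (intro equalityI subsetI)
  fix v assume "v \<in> Apery_set u S"
  then have v: "v \<in> S" "\<And>w. w \<in> S \<Longrightarrow> v \<noteq> w + u"
    by (auto simp: Apery_set_iff)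
  define l where "l = v mod u"
  define q where "q = v div u"
  have vl: "v = l + u * q"
    by (simp add: l_def q_def)
  obtain k where k: "Apery_elem u S l = l + u * k"
    using Apery_elem_props(2)[OF S u] by blast
  have "Apery_elem u S l \<le> v"
    using Apery_elem_props(3)[OF S u, of l "q"] v(1) vl by simp
  then have "k \<le> q"
    using k vl u by simp
  moreover have "\<not> k < q"
  proof
    assume "k < q"
    then obtain m where m: "q = k + m + 1"
      using less_iff_Suc_add by auto
    have "Apery_elem u S l + u * j \<in> S" for j
    proof (induction j)
      case 0
      then show ?case
        using Apery_elem_props(1)[OF S u] by simp
    next
      case (Suc j)
      then have "(Apery_elem u S l + u * j) + u \<in> S"
        using S uS unfolding numerical_semigroup_def by blast
      then show ?case
        by (simp add: ac_simps)
    qed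
    from this[of m] have "(l + u * k + u * m) \<in> S"
      by (simp add: k)
    moreover have "v = (l + u * k + u * m) + u"
      using vl m by (simp add: algebra_simps)
    ultimately show False
      using v(2) by blast
  qed
  ultimately have "v = Apery_elem u S l"
    using k vl by simp
  moreover have "l \<in> {0..u - 1}"
    using mod_less_divisor[OF u, of v] by (simp add: l_def)
  ultimately show "v \<in> Apery_elem u S ` {0..u - 1}"
    by blast
next
  fix v assume "v \<in> Apery_elem u S ` {0..u - 1}"
  then obtain l where l': "l \<in> {0..u - 1}" and l: "v = Apery_elem u S l"
    by blast
  have "l < u"
    using l' u by auto
  obtain k where k: "v = l + u * k"
    using Apery_elem_props(2)[OF S u] l by blast
  have "v \<noteq> w + u" if w: "w \<in> S" for w
  proof
    assume vw: "v = w + u"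
    then have "k > 0"
      using k \<open>l < u\<close> by (cases k) auto
    then have "w = l + u * (k - 1)"
      using vw k by (cases k) auto
    then show False
      using Apery_elem_props(3)[OF S u, of l "k - 1"] w l vw u by simp
  qed
  then show "v \<in> Apery_set u S"
    using Apery_elem_props(1)[OF S u] l by (simp add: Apery_set_iff)
qed

end

theory Submission
  imports Defs
begin

text \<open>
  For a nonzero element \<open>u\<close> of a numerical semigroup \<open>S\<close>, every residue class modulo \<open>u\<close> is cut by \<open>S\<close>
  into an initial run of gaps followed by elements: adding \<open>u\<close> never leaves \<open>S\<close>. The first element
  of the class of \<open>l < u\<close> is the Apery element \<open>a\<^sub>l = l + u * k\<close>, and it is preceded by exactly
  \<open>k = a\<^sub>l div u\<close> gaps. Counting gaps class by class gives
  \<open>g(S) = (\<Sum>l<u. a\<^sub>l div u)\<close> (\<open>genus_eq_sum_Apery_elem_div\<close>).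

  This count is applied to \<open>S/d\<close> and its element \<open>s\<close>. Multiplication by \<open>d\<close> carries the class
  of \<open>i\<close> modulo \<open>s\<close> onto the class of \<open>d * i\<close> modulo \<open>d * s\<close>, and carries membership in \<open>S/d\<close> to
  membership in \<open>S\<close>, so it carries first elements to first elements (\<open>Apery_elem_quotient\<close>). The
  factor \<open>d\<close> then cancels in the quotients \<open>a\<^bsub>di\<^esub> div (d * s)\<close>.
\<close>

lemma numerical_semigroup_add_mult:
  assumes S: "numerical_semigroup S" and "x \<in> S" "u \<in> S"
  shows "x + u * j \<in> S"
proof (induction j)
  case 0
  show ?case using assms by simp
next
  case (Suc j)
  then have "(x + u * j) + u \<in> S"
    using assms unfolding numerical_semigroup_def by blast
  then show ?case by (simp add: ac_simps)
qed

text \<open>Within one residue class, the quotient of the Apery element by \<open>u\<close> is the threshold between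
  gaps and elements, since \<open>S\<close> is stable under adding \<open>u\<close>.\<close>

lemma mem_iff_Apery_elem_div_le:
  assumes S: "numerical_semigroup S" and uS: "u \<in> S" and l: "l < u"
  shows "l + u * k \<in> S \<longleftrightarrow> Apery_elem u S l div u \<le> k"
proof -
  have u: "u > 0" using l by simp
  obtain m where m: "Apery_elem u S l = l + u * m"
    using Apery_elem_props(2)[OF S u] by blast
  have div: "Apery_elem u S l div u = m"
    using l by (simp add: m)
  show ?thesis
  proof
    assume "l + u * k \<in> S"
    then have "l + u * m \<le> l + u * k"
      using Apery_elem_props(3)[OF S u] m by metis
    then show "Apery_elem u S l div u \<le> k"
      using u div by simp
  next
    assume "Apery_elem u S l div u \<le> k"
    then obtain j where "k = m + j"
      using div le_Suc_ex by blast
    then have "l + u * k = Apery_elem u S l + u * j"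
      by (simp add: m algebra_simps)
    then show "l + u * k \<in> S"
      using numerical_semigroup_add_mult[OF S Apery_elem_props(1)[OF S u] uS] by simp
  qed
qed

text \<open>Division with remainder by \<open>u\<close> parametrises the gaps by pairs (residue, quotient) in which the
  quotient lies below the threshold of the residue class.\<close>

lemma genus_eq_sum_Apery_elem_div:
  assumes S: "numerical_semigroup S" and uS: "u \<in> S" and u: "u > 0"
  shows "genus S = (\<Sum>l<u. Apery_elem u S l div u)"
proof -
  let ?P = "SIGMA l:{..<u}. {..<Apery_elem u S l div u}"
  have "bij_betw (\<lambda>(l, k). l + u * k) ?P (UNIV - S)"
  proof (rule bij_betw_byWitness[where f' = "\<lambda>x. (x mod u, x div u)"])
    show "(\<lambda>(l, k). l + u * k) ` ?P \<subseteq> UNIV - S"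
      using mem_iff_Apery_elem_div_le[OF S uS] by fastforce
    show "(\<lambda>x. (x mod u, x div u)) ` (UNIV - S) \<subseteq> ?P"
      using u mem_iff_Apery_elem_div_le[OF S uS, of "x mod u" "x div u" for x]
      by (auto simp: not_le)
  qed auto
  then have "genus S = card ?P"
    by (simp add: genus_def bij_betw_same_card)
  then show ?thesis by simp
qed

lemma Apery_elem_zero:
  assumes S: "numerical_semigroup S" and u: "u > 0"
  shows "Apery_elem u S 0 = 0"
  using Apery_elem_props(3)[OF S u, of 0 0] S by (simp add: numerical_semigroup_def)

lemma Apery_elem_quotient:
  assumes S: "numerical_semigroup S" and d: "d > 0" and s: "s > 0"
  shows "Apery_elem (d * s) S (d * i) = d * Apery_elem s (quotient_semigroup S d) i"
proof (rule antisym)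
  let ?T = "quotient_semigroup S d"
  have T: "numerical_semigroup ?T"
    using numerical_semigroup_quotient[OF S d] .
  have ds: "d * s > 0" using d s by simp
  have scale: "d * i + (d * s) * k = d * (i + s * k)" for k
    by (simp add: algebra_simps)
  show "Apery_elem (d * s) S (d * i) \<le> d * Apery_elem s ?T i"
  proof -
    obtain k where k: "Apery_elem s ?T i = i + s * k"
      using Apery_elem_props(2)[OF T s] by blast
    have "d * i + (d * s) * k \<in> S"
      using Apery_elem_props(1)[OF T s, of i] unfolding scale k
      by (simp add: quotient_semigroup_def)
    then show ?thesis
      using Apery_elem_props(3)[OF S ds] k scale by metis
  qed
  show "d * Apery_elem s ?T i \<le> Apery_elem (d * s) S (d * i)"
  proof -
    obtain k where k: "Apery_elem (d * s) S (d * i) = d * (i + s * k)"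
      using Apery_elem_props(2)[OF S ds, of "d * i"] scale by metis
    then have "i + s * k \<in> ?T"
      using Apery_elem_props(1)[OF S ds, of "d * i"] by (simp add: quotient_semigroup_def)
    then show ?thesis
      using Apery_elem_props(3)[OF T s] k by simp
  qed
qed

text \<open>The Apery set contains one element of each residue class, so the congruences alone
  determine how it is indexed.\<close>

lemma Apery_elem_eqI:
  assumes S: "numerical_semigroup S" and uS: "u \<in> S" and u: "u > 0"
    and v: "v \<in> Apery_set u S" and cong: "[v = l] (mod u)" and l: "l < u"
  shows "v = Apery_elem u S l"
proof -
  obtain m where m: "m \<le> u - 1" "v = Apery_elem u S m"
    using v Apery_set_eq_image[OF S uS u] by auto
  have "[m = l] (mod u)"
    using Apery_elem_cong[OF S u, of m] cong m(2) by (simp add: cong_def)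
  then have "m = l"
    using m(1) l u by (simp add: cong_def)
  then show ?thesis
    using m by simp
qed

theorem mainTheorem6:
  fixes S :: "nat set" and d s :: nat and a :: "nat \<Rightarrow> nat"
  assumes "numerical_semigroup S"
    and "d > 0"
    and "s \<in> quotient_semigroup S d"
    and "s \<noteq> 0"
    and "Apery_set (d * s) S = a ` {0..d * s - 1}"
    and "\<And>l. l \<in> {0..d * s - 1} \<Longrightarrow> [a l = l] (mod (d * s))"
  shows "int (genus (quotient_semigroup S d)) =
           (\<Sum>i = 1..s - 1. \<lfloor>real (a (d * i)) / real (d * s)\<rfloor>)"
proof -
  let ?T = "quotient_semigroup S d"
  let ?A = "Apery_elem s ?T"
  have T: "numerical_semigroup ?T"
    using numerical_semigroup_quotient[OF assms(1,2)] .
  have s: "s > 0" using assms(4) by simp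
  have ds: "d * s > 0" "d * s \<in> S"
    using assms(2,3) s by (auto simp: quotient_semigroup_def)
  have floor_eq: "\<lfloor>real (a (d * i)) / real (d * s)\<rfloor> = int (?A i div s)" if i: "i < s" for i
  proof -
    have di: "d * i < d * s" using i assms(2) by simp
    then have mem: "d * i \<in> {0..d * s - 1}" by (subst atLeastAtMost_iff) linarith
    have "a (d * i) = Apery_elem (d * s) S (d * i)"
      using Apery_elem_eqI[OF assms(1) ds(2,1) _ assms(6)[OF mem] di] assms(5) mem
      by blast
    also have "\<dots> = d * ?A i"
      using Apery_elem_quotient[OF assms(1,2) s] .
    finally have "a (d * i) div (d * s) = ?A i div s"
      using assms(2) by simp
    then show ?thesis
      by (simp only: floor_divide_of_nat_eq)
  qed
  \<comment> \<open>The residue class of \<open>0\<close> has no gaps, so the sum may start at \<open>1\<close>.\<close>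
  have "(\<Sum>i<s. ?A i div s) = (\<Sum>i = 1..s - 1. ?A i div s)"
    by (rule sum.mono_neutral_right) (auto simp: Apery_elem_zero[OF T s] not_le)
  then have "int (genus ?T) = (\<Sum>i = 1..s - 1. int (?A i div s))"
    using genus_eq_sum_Apery_elem_div[OF T assms(3) s] by simp
  also have "\<dots> = (\<Sum>i = 1..s - 1. \<lfloor>real (a (d * i)) / real (d * s)\<rfloor>)"
    using s by (intro sum.cong refl floor_eq[symmetric]) auto
  finally show ?thesis .
qed

end
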